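(* Let $\{X_n\}_{n\in\mathbb{N}}$ be a sequence of finite connected graphs with uniformly bounded degree and $|X_n|\to\infty$. Then $\{X_n\}_{n\in\mathbb{N}}$ is a sequence of asymptotic expanders if and only if it admits a uniform exhaustion by expanders.
   Context: Graphs are undirected, without loops or multiple edges, identified with their vertex sets; connected graphs carry the path metric. A subset $Y$ of the vertices of a graph $X$ is regarded as the (possibly disconnected) full subgraph spanned by $Y$. For a metric space $(X,d)$, $A\subseteq X$ and $R>0$, let $\partial_R A=\{x\in X\setminus A : d(x,A)\le R\}$. For a graph $X$ and $A\subseteq X$, let $\partial A$ be the set of vertices of $X\setminus A$ adjacent to some vertex of $A$. A sequence $\{X_n\}_{n\in\mathbb{N}}$ of finite metric spaces with $|X_n|\to\infty$ is a sequence of asymptotic expanders if for every $\alpha\in(0,\frac12]$ there exist $c_\alpha\in(0,1)$ and $R_\alpha>0$ such that for every $n$ and every $A\subseteq X_n$ with $\alpha|X_n|\le|A|\le\frac12|X_n|$ we have $|\partial_{R_\alpha}A|>c_\alpha|A|$. For $c>0$, a subset $A$ of a finite graph $X$ is $c$-Følner if $|A|\le\frac12|X|$ and $|\partial A|\le c|A|$. A finite graph is a $c$-expander if it has no non-empty $c$-Følner sets. A sequence $\{X_n\}$ of finite graphs with uniformly bounded degrees and $|X_n|\to\infty$ admits a uniform exhaustion by expanders if there exist sequences of real numbers $\{\alpha_k\}_{k\in\mathbb{N}}$, $\{c_k\}_{k\in\mathbb{N}}$ with $c_k>0$ and $\alpha_k\to0$, and subsets $Y_{n,k}\subseteq X_n$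 such that, for all $n,k\in\mathbb{N}$, $Y_{n,k}$ (as a full subgraph of $X_n$) is a $c_k$-expander and $|Y_{n,k}|\ge(1-\alpha_k)|X_n|$. *)

theory Defs
  imports
    "HOL-Analysis.Abstract_Metric_Spaces"
    "Graph_Theory.Digraph_Component"
    "Graph_Theory.Shortest_Path"
begin

text \<open>
  A finite simple graph is a digraph satisfying the locale predicate \<^const>\<open>graph\<close> (finite,
  symmetric, no loops, no parallel arcs): each undirected edge is a pair of opposite arcs, so the
  degree of a vertex is its out-degree.  Connectedness is \<^const>\<open>Digraph_Component.connected\<close>,
  which includes non-emptiness of the vertex set.
\<close>

definition path_metric :: "('a, 'b) pre_digraph \<Rightarrow> 'a \<Rightarrow> 'a \<Rightarrow> real" where
  "path_metric G u v = real_of_ereal (wf_digraph.\<mu> G (\<lambda>_. 1) u v)"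

text \<open>
  The distance from a point to a set is an infimum in the extended reals, so that the distance
  to the empty set is infinite.
\<close>

definition metric_boundary :: "'a set \<Rightarrow> ('a \<Rightarrow> 'a \<Rightarrow> real) \<Rightarrow> real \<Rightarrow> 'a set \<Rightarrow> 'a set" where
  "metric_boundary M d R A = {x \<in> M - A. (INF a\<in>A. ereal (d x a)) \<le> ereal R}"

text \<open>
  \<^const>\<open>Metric_space\<close> also asks for symmetry and non-negativity off the carrier.  This costs
  nothing for \<^const>\<open>path_metric\<close>, whose value is 0 as soon as one argument is not a vertex.
\<close>

definition asymptotic_expanders :: "(nat \<Rightarrow> 'a set) \<Rightarrow> (nat \<Rightarrow> 'a \<Rightarrow> 'a \<Rightarrow> real) \<Rightarrow> bool" where
  "asymptotic_expanders M d \<longleftrightarrow>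
     (\<forall>n. finite (M n) \<and> Metric_space (M n) (d n)) \<and>
     filterlim (\<lambda>n. card (M n)) at_top sequentially \<and>
     (\<forall>\<alpha>::real. 0 < \<alpha> \<and> \<alpha> \<le> 1/2 \<longrightarrow>
       (\<exists>c R::real. 0 < c \<and> c < 1 \<and> 0 < R \<and>
         (\<forall>n. \<forall>A \<subseteq> M n.
            \<alpha> * real (card (M n)) \<le> real (card A) \<and> real (card A) \<le> 1/2 * real (card (M n)) \<longrightarrow>
            real (card (metric_boundary (M n) (d n) R A)) > c * real (card A))))"

definition vertex_boundary :: "('a, 'b) pre_digraph \<Rightarrow> 'a set \<Rightarrow> 'a set" where
  "vertex_boundary G A = {x \<in> verts G - A. \<exists>a\<in>A. x \<rightarrow>\<^bsub>G\<^esub> a}"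

definition Folner_set :: "real \<Rightarrow> ('a, 'b) pre_digraph \<Rightarrow> 'a set \<Rightarrow> bool" where
  "Folner_set c G A \<longleftrightarrow>
     A \<subseteq> verts G \<and>
     real (card A) \<le> 1/2 * real (card (verts G)) \<and>
     real (card (vertex_boundary G A)) \<le> c * real (card A)"

definition expander :: "real \<Rightarrow> ('a, 'b) pre_digraph \<Rightarrow> bool" where
  "expander c G \<longleftrightarrow> graph G \<and> \<not> (\<exists>A. A \<noteq> {} \<and> Folner_set c G A)"

definition uniformly_bounded_degrees :: "(nat \<Rightarrow> ('a, 'b) pre_digraph) \<Rightarrow> bool" where
  "uniformly_bounded_degrees X \<longleftrightarrow> (\<exists>D. \<forall>n. \<forall>v \<in> verts (X n). out_degree (X n) v \<le> D)"

definition uniform_exhaustion_by_expanders :: "(nat \<Rightarrow> ('a, 'b) pre_digraph) \<Rightarrow> bool" where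
  "uniform_exhaustion_by_expanders X \<longleftrightarrow>
     (\<forall>n. graph (X n)) \<and>
     uniformly_bounded_degrees X \<and>
     filterlim (\<lambda>n. card (verts (X n))) at_top sequentially \<and>
     (\<exists>(\<alpha> :: nat \<Rightarrow> real) (c :: nat \<Rightarrow> real) (Y :: nat \<Rightarrow> nat \<Rightarrow> 'a set).
        (\<forall>k. c k > 0) \<and> \<alpha> \<longlonglongrightarrow> 0 \<and>
        (\<forall>n k. Y n k \<subseteq> verts (X n) \<and>
               expander (c k) (X n \<restriction> Y n k) \<and>
               real (card (Y n k)) \<ge> (1 - \<alpha> k) * real (card (verts (X n)))))"

end

theory Submission
  imports Defs
begin

text \<open>
  In degree at most \<open>D\<close>, the \<open>R\<close>-boundary of a set is at most a constant (depending on \<open>R\<close> and \<open>D\<close>)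
  times larger than its vertex boundary, so asymptotic expansion only concerns vertex boundaries.
  Given an asymptotic expander, remove an inclusion-maximal Folner set \<open>F\<close>.  It is small, because large
  Folner sets do not exist.  A Folner set \<open>B\<close> of the remainder \<open>Y\<close> would make \<open>F \<union> B\<close> a Folner set
  larger than \<open>F\<close>, or, if \<open>F \<union> B\<close> exceeds half of the graph, make its complement a large set of small
  boundary.  Conversely, if an expander \<open>Y\<close> misses only a small part of the graph, then a set \<open>A\<close> that
  is not small expands inside \<open>Y\<close>: either \<open>A \<inter> Y\<close> or \<open>Y - A\<close> is at most half of \<open>Y\<close>.
\<close>

section \<open>The path metric of a connected graph\<close>

lemma (in wf_digraph) awalk_cost_one: "awalk_cost (\<lambda>_. 1) p = real (length p)"
  by (induction p) auto

context graph
begin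

lemma dominates_sym: "x \<rightarrow>\<^bsub>G\<^esub> y \<Longrightarrow> y \<rightarrow>\<^bsub>G\<^esub> x"
  using arcs_ends_symmetric[OF sym_arcs] by blast

text \<open>Every arc has an opposite arc, so a walk can be traversed backwards arc by arc. This is
  what makes the path metric symmetric.\<close>

lemma awalk_reverse: "awalk u p v \<Longrightarrow> \<exists>q. awalk v q u \<and> length q = length p"
proof (induction p arbitrary: u)
  case Nil
  then show ?case by (auto intro!: exI[of _ "[]"] simp: awalk_Nil_iff)
next
  case (Cons e p)
  then have e: "e \<in> arcs G" "u = tail G e" and "awalk (head G e) p v"
    by (auto simp: awalk_Cons_iff)
  from Cons.IH[OF this(3)] obtain q where q: "awalk v q (head G e)" "length q = length p"
    by blast
  obtain f where f: "f \<in> arcs G" "tail G f = head G e" "head G f = tail G e"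
    using e(1) sym_arcs unfolding symmetric_conv by metis
  have "awalk (head G e) [f] u"
    using f e by (auto simp: awalk_simps)
  with q have "awalk v (q @ [f]) u"
    by (blast intro: awalk_appendI)
  with q(2) show ?case by (intro exI[of _ "q @ [f]"]) auto
qed

lemma path_metric_nonneg: "0 \<le> path_metric G u v"
  unfolding path_metric_def \<mu>_def
  by (intro real_of_ereal_pos INF_greatest) (simp add: awalk_cost_one)

text \<open>Reversal of walks compares the two infima directly, so unreachable pairs and points
  outside the vertex set are covered too, as \<open>Metric_space\<close> demands.\<close>

lemma path_metric_commute: "path_metric G u v = path_metric G v u"
proof -
  have "\<mu> (\<lambda>_. 1) u v \<le> \<mu> (\<lambda>_. 1) v u" for u v
    unfolding \<mu>_def
  proof (rule INF_mono)
    fix p assume "p \<in> {p. awalk v p u}"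
    then obtain q where "awalk u q v" "length q = length p"
      using awalk_reverse by blast
    then show "\<exists>q\<in>{p. awalk u p v}. ereal (awalk_cost (\<lambda>_. 1) q) \<le> ereal (awalk_cost (\<lambda>_. 1) p)"
      by (auto simp: awalk_cost_one)
  qed
  then show ?thesis
    unfolding path_metric_def by (metis antisym)
qed

text \<open>Unit weights are non-negative, so a path attains the infimum over walks. Reachability
  excludes the value infinity, which \<open>real_of_ereal\<close> would turn into 0.\<close>

lemma path_metric_attained:
  assumes "u \<rightarrow>\<^sup>* v"
  obtains p where "awalk u p v" "path_metric G u v = real (length p)"
proof -
  obtain p where "apath u p v" "\<mu> (\<lambda>_. 1) u v = awalk_cost (\<lambda>_. 1) p"
    using min_cost_awalk[OF assms, of "\<lambda>_. 1"] by auto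
  then show ?thesis
    using that by (auto simp: path_metric_def awalk_cost_one apath_def)
qed

lemma path_metric_le_length:
  assumes "awalk u p v"
  shows "path_metric G u v \<le> real (length p)"
proof -
  have "u \<rightarrow>\<^sup>* v" using assms by (rule reachable_awalkI)
  from min_cost_awalk[OF this, of "\<lambda>_. 1"]
  obtain q where q: "\<mu> (\<lambda>_. 1) u v = awalk_cost (\<lambda>_. 1) q" by auto
  show ?thesis
    using min_cost_le_walk_cost[OF assms, of "\<lambda>_. 1"] q
    by (simp add: path_metric_def awalk_cost_one)
qed

text \<open>Connectedness concerns the symmetrised digraph, in which reachability is the same as in
  \<open>G\<close> because the arcs of \<open>G\<close> are already symmetric.\<close>

lemma connected_imp_reachable:
  "Digraph_Component.connected G \<Longrightarrow> u \<in> verts G \<Longrightarrow> v \<in> verts G \<Longrightarrow> u \<rightarrow>\<^sup>* v"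
  unfolding Digraph_Component.connected_def strongly_connected_def
  by (simp add: reachable_mk_symmetric_eq[OF sym_arcs])

lemma Metric_space_path_metric:
  assumes conn: "Digraph_Component.connected G"
  shows "Metric_space (verts G) (path_metric G)"
proof
  fix x y assume xy: "x \<in> verts G" "y \<in> verts G"
  obtain p where p: "awalk x p y" "path_metric G x y = real (length p)"
    using path_metric_attained[OF connected_imp_reachable[OF conn xy]] .
  have "path_metric G x x \<le> 0"
    using path_metric_le_length[of x "[]" x] xy by (simp add: awalk_Nil_iff)
  with path_metric_nonneg[of x x] p show "path_metric G x y = 0 \<longleftrightarrow> x = y"
    by (auto simp: awalk_Nil_iff)
next
  fix x y z assume xyz: "x \<in> verts G" "y \<in> verts G" "z \<in> verts G"
  obtain p where p: "awalk x p y" "path_metric G x y = real (length p)"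
    using path_metric_attained[OF connected_imp_reachable[OF conn]] xyz by blast
  obtain q where q: "awalk y q z" "path_metric G y z = real (length q)"
    using path_metric_attained[OF connected_imp_reachable[OF conn]] xyz by blast
  show "path_metric G x z \<le> path_metric G x y + path_metric G y z"
    using path_metric_le_length[OF awalk_appendI[OF p(1) q(1)]] p q by simp
qed (auto intro: path_metric_nonneg path_metric_commute)


section \<open>Metric and vertex boundaries\<close>

lemma finite_subset_verts: "S \<subseteq> verts G \<Longrightarrow> finite S"
  by (rule finite_subset[OF _ finite_verts])

lemma vertex_boundary_subset: "vertex_boundary G A \<subseteq> verts G"
  by (auto simp: vertex_boundary_def)

text \<open>The out-neighbourhoods of the points of \<open>T\<close> cover \<open>S\<close>, and
  each has at most \<open>D\<close> points. This is the only use of bounded degree: it bounds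
  successive layers around a set and compares the boundary of a set with that of its
  complement.\<close>

lemma card_neighbours_le:
  assumes "\<And>v. v \<in> verts G \<Longrightarrow> out_degree G v \<le> D"
    and "T \<subseteq> verts G" and "\<And>x. x \<in> S \<Longrightarrow> \<exists>t\<in>T. t \<rightarrow>\<^bsub>G\<^esub> x"
  shows "card S \<le> D * card T"
proof -
  have fin: "finite T" using assms(2) by (rule finite_subset_verts)
  have "S \<subseteq> (\<Union>t\<in>T. head G ` out_arcs G t)"
    using assms(3) by (fastforce simp: arcs_ends_conv)
  then have "card S \<le> card (\<Union>t\<in>T. head G ` out_arcs G t)"
    by (intro card_mono) (auto simp: fin finite_out_arcs)
  also have "\<dots> \<le> (\<Sum>t\<in>T. card (head G ` out_arcs G t))"
    by (rule card_UN_le[OF fin])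
  also have "\<dots> \<le> (\<Sum>t\<in>T. D)"
    using assms(1,2) by (intro sum_mono order_trans[OF card_image_le])
      (auto simp: finite_out_arcs out_degree_def)
  finally show ?thesis by (simp add: mult.commute)
qed

lemma vertex_boundary_subset_metric_boundary:
  "vertex_boundary G A \<subseteq> metric_boundary (verts G) (path_metric G) 1 A"
proof
  fix x assume "x \<in> vertex_boundary G A"
  then obtain a where x: "x \<in> verts G - A" and a: "a \<in> A" "x \<rightarrow>\<^bsub>G\<^esub> a"
    by (auto simp: vertex_boundary_def)
  obtain e where "e \<in> arcs G" "tail G e = x" "head G e = a"
    using a(2) by auto
  then have "awalk x [e] a" by (auto simp: awalk_simps)
  from path_metric_le_length[OF this] have "ereal (path_metric G x a) \<le> ereal 1"
    by simp
  with a(1) have "(INF a\<in>A. ereal (path_metric G x a)) \<le> ereal 1"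
    by (rule INF_lower2)
  with x show "x \<in> metric_boundary (verts G) (path_metric G) 1 A"
    by (simp add: metric_boundary_def)
qed

text \<open>For a set \<open>A\<close> of vertices this is its closed \<open>k\<close>-neighbourhood
  in the path metric, built layer by layer so that each layer can be counted from the previous
  one.\<close>

definition thicken :: "nat \<Rightarrow> 'a set \<Rightarrow> 'a set" where
  "thicken k A = ((\<lambda>B. B \<union> vertex_boundary G B) ^^ k) A"

lemma thicken_0: "thicken 0 A = A"
  and thicken_Suc: "thicken (Suc k) A = thicken k A \<union> vertex_boundary G (thicken k A)"
  by (simp_all add: thicken_def)

lemma thicken_mono: "k \<le> l \<Longrightarrow> thicken k A \<subseteq> thicken l A"
  by (rule lift_Suc_mono_le[of "\<lambda>k. thicken k A"]) (auto simp: thicken_Suc)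

text \<open>Going backwards along a walk that ends in \<open>A\<close>, each arc leads at most one
  layer further out.\<close>

lemma awalk_imp_in_thicken:
  "awalk x p a \<Longrightarrow> a \<in> A \<Longrightarrow> x \<in> thicken (length p) A"
proof (induction p arbitrary: x)
  case Nil
  then show ?case by (simp add: awalk_Nil_iff thicken_0)
next
  case (Cons e p)
  then have "head G e \<in> thicken (length p) A" "x \<rightarrow>\<^bsub>G\<^esub> head G e" "x \<in> verts G"
    by (auto simp: awalk_Cons_iff arcs_ends_conv)
  then show ?case
    by (auto simp: thicken_Suc vertex_boundary_def)
qed

lemma card_vertex_boundary_thicken_le:
  assumes deg: "\<And>v. v \<in> verts G \<Longrightarrow> out_degree G v \<le> D"
  shows "card (vertex_boundary G (thicken k A)) \<le> D ^ k * card (vertex_boundary G A)"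
proof (induction k)
  case 0
  then show ?case by (simp add: thicken_0)
next
  case (Suc k)
  have "card (vertex_boundary G (thicken (Suc k) A)) \<le> D * card (vertex_boundary G (thicken k A))"
  proof (rule card_neighbours_le[OF deg vertex_boundary_subset])
    fix x assume "x \<in> vertex_boundary G (thicken (Suc k) A)"
    then obtain y where x: "x \<in> verts G" "x \<notin> thicken k A" "x \<notin> vertex_boundary G (thicken k A)"
      and y: "y \<in> thicken k A \<or> y \<in> vertex_boundary G (thicken k A)" "x \<rightarrow>\<^bsub>G\<^esub> y"
      unfolding thicken_Suc vertex_boundary_def[of G "_ \<union> _"] by blast
    \<comment> \<open>Otherwise \<open>x\<close> would already lie in the boundary of
      \<open>thicken k A\<close>. So a new layer is adjacent only to the layer just added, which
      gives one factor \<open>D\<close> per step.\<close>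
    then have "y \<notin> thicken k A"
      by (auto simp: vertex_boundary_def)
    with y have "y \<in> vertex_boundary G (thicken k A)" "y \<rightarrow>\<^bsub>G\<^esub> x"
      by (auto intro: dominates_sym)
    then show "\<exists>t\<in>vertex_boundary G (thicken k A). t \<rightarrow>\<^bsub>G\<^esub> x"
      by blast
  qed
  also have "\<dots> \<le> D * (D ^ k * card (vertex_boundary G A))"
    using Suc.IH by (rule mult_le_mono2)
  finally show ?case by (simp add: mult.assoc)
qed

text \<open>The points added to \<open>A\<close> form \<open>k\<close> layers, the boundaries of
  \<open>thicken i A\<close> for \<open>i < k\<close>; summing their bounds gives the geometric
  sum.\<close>

lemma card_thicken_diff_le:
  assumes deg: "\<And>v. v \<in> verts G \<Longrightarrow> out_degree G v \<le> D"
  shows "card (thicken k A - A) \<le> (\<Sum>i<k. D ^ i) * card (vertex_boundary G A)"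
proof (induction k)
  case 0
  then show ?case by (simp add: thicken_0)
next
  case (Suc k)
  have sub: "thicken k A - A \<subseteq> verts G" for k
    by (induction k) (auto simp: thicken_0 thicken_Suc vertex_boundary_def)
  have "card (thicken (Suc k) A - A)
      \<le> card ((thicken k A - A) \<union> vertex_boundary G (thicken k A))"
    by (rule card_mono)
      (auto simp: thicken_Suc finite_subset_verts sub vertex_boundary_subset)
  also have "\<dots> \<le> card (thicken k A - A) + card (vertex_boundary G (thicken k A))"
    by (rule card_Un_le)
  also have "\<dots> \<le> (\<Sum>i<k. D ^ i) * card (vertex_boundary G A) + D ^ k * card (vertex_boundary G A)"
    by (intro add_mono Suc.IH card_vertex_boundary_thicken_le deg)
  finally show ?case by (simp add: algebra_simps)
qed

lemma card_metric_boundary_le: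
  assumes conn: "Digraph_Component.connected G"
    and deg: "\<And>v. v \<in> verts G \<Longrightarrow> out_degree G v \<le> D"
    and A: "A \<subseteq> verts G" and R: "R \<le> real k"
  shows "card (metric_boundary (verts G) (path_metric G) R A)
           \<le> (\<Sum>i<Suc k. D ^ i) * card (vertex_boundary G A)"
proof -
  have "metric_boundary (verts G) (path_metric G) R A \<subseteq> thicken (Suc k) A - A"
  proof
    fix x assume "x \<in> metric_boundary (verts G) (path_metric G) R A"
    then have x: "x \<in> verts G" "x \<notin> A" and le: "(INF a\<in>A. ereal (path_metric G x a)) \<le> ereal R"
      by (auto simp: metric_boundary_def)
    \<comment> \<open>An infimum that is at most \<open>R\<close> does not by itself yield a point
      of \<open>A\<close> at distance at most \<open>R\<close>. The strict bound by
      \<open>Suc k\<close> does, at the price of one more layer.\<close>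
    note le
    also have "ereal R < ereal (real (Suc k))" using R by simp
    finally obtain a where a: "a \<in> A" "path_metric G x a < real (Suc k)"
      by (auto simp: INF_less_iff)
    obtain p where p: "awalk x p a" "path_metric G x a = real (length p)"
      using path_metric_attained[OF connected_imp_reachable[OF conn]] x(1) a(1) A by blast
    with a have "thicken (length p) A \<subseteq> thicken (Suc k) A"
      by (intro thicken_mono) simp
    with awalk_imp_in_thicken[OF p(1) a(1)] x show "x \<in> thicken (Suc k) A - A"
      by blast
  qed
  moreover have "thicken (Suc k) A \<subseteq> verts G"
    using A by (induction k) (auto simp: thicken_0 thicken_Suc vertex_boundary_def)
  ultimately have "card (metric_boundary (verts G) (path_metric G) R A) \<le> card (thicken (Suc k) A - A)"
    by (intro card_mono) (auto intro: finite_subset_verts)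
  also note card_thicken_diff_le[OF deg]
  finally show ?thesis .
qed


section \<open>Large expander subgraphs\<close>

lemma graph_induce_subgraph:
  assumes "S \<subseteq> verts G"
  shows "graph (G \<restriction> S)"
proof -
  have ind: "induced_subgraph (G \<restriction> S) G"
    using assms by (rule induced_induce)
  interpret H: digraph "G \<restriction> S" by (rule digraphI_induced[OF ind])
  show ?thesis
    by (rule H.graphI, rule induced_graph_imp_symmetric[OF sym_arcs ind])
qed

lemma dominates_induce_subgraph_iff:
  "x \<rightarrow>\<^bsub>G \<restriction> S\<^esub> y \<longleftrightarrow> x \<in> S \<and> y \<in> S \<and> x \<rightarrow>\<^bsub>G\<^esub> y"
  unfolding arcs_ends_conv image_iff by auto

lemma vertex_boundary_induce_subgraph:
  "B \<subseteq> S \<Longrightarrow> vertex_boundary (G \<restriction> S) B = {x \<in> S - B. \<exists>b\<in>B. x \<rightarrow>\<^bsub>G\<^esub> b}"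
  by (auto simp: vertex_boundary_def dominates_induce_subgraph_iff)

lemma expander_induce_subgraph_vertex_boundary:
  assumes "expander c (G \<restriction> S)" "B \<subseteq> S" "B \<noteq> {}" "2 * card B \<le> card S"
  shows "c * real (card B) < real (card (vertex_boundary (G \<restriction> S) B))"
proof -
  have "real (card B) \<le> 1/2 * real (card S)"
    using assms(4) by simp
  then show ?thesis
    using assms(1,2,3) unfolding expander_def Folner_set_def by auto
qed

text \<open>The constant is small enough that \<open>D\<close> times the boundary of \<open>F \<union> B\<close> stays below the
  boundary that the complement of \<open>F \<union> B\<close>, of size at least \<open>3/8\<close> of the graph, must have.\<close>

lemma exists_large_expander_subgraph:
  assumes deg: "\<And>v. v \<in> verts G \<Longrightarrow> out_degree G v \<le> D"
    and \<alpha>: "0 < \<alpha>" "\<alpha> \<le> 1/4" and c: "0 < c"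
    and ne: "verts G \<noteq> {}"
    and exp: "\<And>A. A \<subseteq> verts G \<Longrightarrow> \<alpha> * real (card (verts G)) \<le> real (card A) \<Longrightarrow>
      real (card A) \<le> 1/2 * real (card (verts G)) \<Longrightarrow>
      real (card (vertex_boundary G A)) > c * real (card A)"
  shows "\<exists>Y \<subseteq> verts G. expander (c / (4 * real D + 4)) (G \<restriction> Y) \<and>
           real (card Y) \<ge> (1 - \<alpha>) * real (card (verts G))"
proof -
  define N where "N = real (card (verts G))"
  define c' where "c' = c / (4 * real D + 4)"
  have N: "N > 0" using ne by (simp add: N_def card_gt_0_iff)
  \<comment> \<open>The bound \<open>c' \<le> c\<close> will show that a Folner set is small; the
    bound on \<open>real D * c'\<close> serves the case where \<open>F \<union> B\<close> exceeds
    half of the graph.\<close>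
  have c': "0 < c'" "c' \<le> c" "real D * c' \<le> c / 4"
    using c by (auto simp: c'_def field_simps)
  have "{F. Folner_set c' G F} \<subseteq> Pow (verts G)"
    by (auto simp: Folner_set_def)
  then have "finite {F. Folner_set c' G F}"
    by (rule finite_subset) simp
  moreover have "{} \<in> {F. Folner_set c' G F}"
    by (simp add: Folner_set_def vertex_boundary_def)
  ultimately have "\<exists>F\<in>{F. Folner_set c' G F}. \<forall>F'\<in>{F. Folner_set c' G F}. F \<subseteq> F' \<longrightarrow> F = F'"
    by (intro finite_has_maximal) auto
  then obtain F where F: "Folner_set c' G F"
    and maximal: "\<And>F'. Folner_set c' G F' \<Longrightarrow> F \<subseteq> F' \<Longrightarrow> F = F'"
    by auto
  have Fv: "F \<subseteq> verts G" "real (card F) \<le> 1/2 * N" "real (card (vertex_boundary G F)) \<le> c' * real (card F)"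
    using F by (auto simp: Folner_set_def N_def)
  have F_small: "real (card F) < \<alpha> * N"
  proof (rule ccontr)
    assume "\<not> real (card F) < \<alpha> * N"
    then have "c * real (card F) < real (card (vertex_boundary G F))"
      using exp[OF Fv(1)] Fv(2) by (simp add: N_def)
    moreover have "c' * real (card F) \<le> c * real (card F)"
      using c' by (intro mult_right_mono) auto
    ultimately show False using Fv(3) by linarith
  qed
  define Y where "Y = verts G - F"
  have Yv: "Y \<subseteq> verts G" by (auto simp: Y_def)
  have card_Y: "real (card Y) = N - real (card F)"
    using Fv(1) by (simp add: Y_def N_def card_Diff_subset finite_subset_verts of_nat_diff card_mono)
  have no_Folner: "\<not> Folner_set c' (G \<restriction> Y) B" if "B \<noteq> {}" for B
  proof
    assume "Folner_set c' (G \<restriction> Y) B"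
    then have B: "B \<subseteq> Y" "real (card B) \<le> 1/2 * real (card Y)"
      "real (card (vertex_boundary (G \<restriction> Y) B)) \<le> c' * real (card B)"
      by (auto simp: Folner_set_def)
    have FB: "F \<union> B \<subseteq> verts G" using B(1) Fv(1) Yv by auto
    have disj: "F \<inter> B = {}" using B(1) by (auto simp: Y_def)
    have fin: "finite F" "finite B"
      using B(1) Fv(1) Yv by (auto intro: finite_subset_verts)
    have card_FB: "real (card (F \<union> B)) = real (card F) + real (card B)"
      using disj fin by (simp add: card_Un_disjoint)
    \<comment> \<open>A point outside \<open>F \<union> B\<close> adjacent to \<open>F\<close> is in
      the boundary of \<open>F\<close>; one adjacent to \<open>B\<close> lies in
      \<open>Y - B\<close>, hence in the boundary of \<open>B\<close> within \<open>Y\<close>. So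
      the two Folner inequalities add up.\<close>
    have "vertex_boundary G (F \<union> B) \<subseteq> vertex_boundary G F \<union> vertex_boundary (G \<restriction> Y) B"
      unfolding vertex_boundary_induce_subgraph[OF B(1)] by (auto simp: vertex_boundary_def Y_def)
    then have "card (vertex_boundary G (F \<union> B))
        \<le> card (vertex_boundary G F \<union> vertex_boundary (G \<restriction> Y) B)"
      using Yv vertex_boundary_subset[of F] vertex_boundary_induce_subgraph[OF B(1)]
      by (intro card_mono finite_subset_verts) auto
    also have "\<dots> \<le> card (vertex_boundary G F) + card (vertex_boundary (G \<restriction> Y) B)"
      by (rule card_Un_le)
    finally have bd: "real (card (vertex_boundary G (F \<union> B))) \<le> c' * real (card (F \<union> B))"
      using Fv(3) B(3) unfolding card_FB distrib_left by linarith
    show False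
    proof (cases "real (card (F \<union> B)) \<le> 1/2 * N")
      case True
      then have "Folner_set c' G (F \<union> B)"
        using FB bd by (simp add: Folner_set_def N_def)
      then have "F = F \<union> B" by (rule maximal) auto
      with that disj show False by auto
    next
      case False
      define Z where "Z = verts G - (F \<union> B)"
      have Zv: "Z \<subseteq> verts G" by (auto simp: Z_def)
      have card_Z: "real (card Z) = N - real (card (F \<union> B))"
        using FB fin
        by (simp add: Z_def N_def card_Diff_subset of_nat_diff card_mono del: card_Un_disjoint)
      \<comment> \<open>Since \<open>B\<close> is at most half of \<open>Y\<close>, the set
        \<open>F \<union> B\<close> has at most \<open>(N + card F) / 2\<close> points, which is
        less than \<open>5/8 * N\<close> because \<open>card F < N / 4\<close>.\<close>
      have Z_ge: "real (card Z) \<ge> 3/8 * N"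
      proof -
        have "\<alpha> * N \<le> 1/4 * N" using \<alpha> N by (intro mult_right_mono) auto
        with F_small B(2) card_Z card_FB card_Y show ?thesis by linarith
      qed
      have "\<alpha> * N \<le> 3/8 * N" using \<alpha> N by (intro mult_right_mono) auto
      with Z_ge have "\<alpha> * N \<le> real (card Z)" by linarith
      then have Z_exp: "c * real (card Z) < real (card (vertex_boundary G Z))"
        using exp[OF Zv] False card_Z by (simp add: N_def)
      \<comment> \<open>The boundary of \<open>Z\<close> lies inside \<open>F \<union> B\<close>;
        each of its points has a neighbour in \<open>Z\<close>, and that neighbour is in the
        boundary of \<open>F \<union> B\<close>.\<close>
      have "card (vertex_boundary G Z) \<le> D * card (vertex_boundary G (F \<union> B))"
      proof (rule card_neighbours_le[OF deg vertex_boundary_subset])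
        fix x assume "x \<in> vertex_boundary G Z"
        then obtain z where "x \<in> F \<union> B" "z \<in> Z" "x \<rightarrow>\<^bsub>G\<^esub> z"
          by (auto simp: vertex_boundary_def Z_def)
        then show "\<exists>t\<in>vertex_boundary G (F \<union> B). t \<rightarrow>\<^bsub>G\<^esub> x"
          using dominates_sym by (auto simp: vertex_boundary_def Z_def)
      qed
      then have "real (card (vertex_boundary G Z)) \<le> real D * real (card (vertex_boundary G (F \<union> B)))"
        by (metis of_nat_le_iff of_nat_mult)
      also have "\<dots> \<le> real D * (c' * real (card (F \<union> B)))"
        using bd by (intro mult_left_mono) auto
      also have "\<dots> \<le> (c / 4) * real (card (F \<union> B))"
        using c'(3) by (simp add: mult.assoc[symmetric] mult_right_mono del: times_divide_eq_left)
      also have "\<dots> \<le> (c / 4) * N"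
        using FB c by (intro mult_left_mono) (auto simp: N_def card_mono)
      finally have "c * real (card Z) < (c / 4) * N" using Z_exp by linarith
      moreover have "c * (3/8 * N) \<le> c * real (card Z)"
        using Z_ge c by (intro mult_left_mono) auto
      moreover have "0 < c * N" using c N by simp
      ultimately show False by (simp add: field_simps)
    qed
  qed
  have "expander c' (G \<restriction> Y)"
    using no_Folner graph_induce_subgraph[OF Yv] by (auto simp: expander_def)
  moreover have "(1 - \<alpha>) * N \<le> real (card Y)"
    using F_small card_Y by (simp add: algebra_simps)
  ultimately show ?thesis
    using Yv unfolding c'_def N_def by blast
qed

text \<open>Whichever of \<open>A \<inter> Y\<close> and \<open>Y - A\<close> is at most half of
  \<open>Y\<close> still has at least half the size of \<open>A\<close>, so it expands inside
  \<open>Y\<close>. Its boundary in \<open>Y\<close> is part of the boundary of \<open>A\<close> in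
  the first case, and consists of points of \<open>A\<close> adjacent to that boundary in the
  second.\<close>

lemma expander_subgraph_imp_vertex_boundary:
  assumes deg: "\<And>v. v \<in> verts G \<Longrightarrow> out_degree G v \<le> D"
    and \<alpha>: "0 < \<alpha>" "\<alpha> \<le> 1/2" and \<epsilon>: "\<epsilon> \<le> \<alpha> / 2" and c: "0 < c"
    and ne: "verts G \<noteq> {}"
    and Y: "Y \<subseteq> verts G" "expander c (G \<restriction> Y)" "(1 - \<epsilon>) * real (card (verts G)) \<le> real (card Y)"
    and A: "A \<subseteq> verts G" "\<alpha> * real (card (verts G)) \<le> real (card A)"
      "real (card A) \<le> 1/2 * real (card (verts G))"
  shows "real (card (vertex_boundary G A)) > c / (2 * real D + 2) * real (card A)"
proof -
  define N where "N = real (card (verts G))"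
  have N: "N > 0" using ne by (simp add: N_def card_gt_0_iff)
  have A_pos: "0 < real (card A)"
    using A(2) \<alpha>(1) N mult_pos_pos[of \<alpha> N] unfolding N_def by linarith
  have eN: "\<epsilon> * N \<le> \<alpha> * N / 2"
    using mult_right_mono[OF \<epsilon>, of N] N by simp
  have fin: "finite A" "finite Y" using A(1) Y(1) by (auto intro: finite_subset_verts)
  have Y_ge: "N - \<epsilon> * N \<le> real (card Y)" using Y(3) by (simp add: N_def algebra_simps)
  have Y_split: "real (card Y) = real (card (A \<inter> Y)) + real (card (Y - A))"
    using card_Diff_subset_Int[of Y A] fin card_mono[of Y "Y \<inter> A"]
    by (simp add: Int_commute of_nat_diff)
  have bd_fin: "finite (vertex_boundary G A)"
    using vertex_boundary_subset by (rule finite_subset_verts)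
  \<comment> \<open>The factor \<open>real D + 1\<close> serves both cases: the first needs the
    factor 1, the second \<open>D\<close>.\<close>
  have "c * real (card A) / 2 < (real D + 1) * real (card (vertex_boundary G A))"
  proof (cases "2 * card (A \<inter> Y) \<le> card Y")
    case True
    have "card (A \<union> Y) \<le> card (verts G)"
      using A(1) Y(1) by (intro card_mono) auto
    then have "real (card A) + real (card Y) - real (card (A \<inter> Y)) \<le> N"
      using card_Un_Int[OF fin] unfolding N_def by linarith
    \<comment> \<open>At most \<open>\<epsilon> * N\<close> points of \<open>A\<close> lie outside
      \<open>Y\<close>, and \<open>\<epsilon> * N \<le> \<alpha> * N / 2\<close> is at most half of
      \<open>card A\<close>.\<close>
    then have AY: "real (card A) / 2 \<le> real (card (A \<inter> Y))"
      using Y_ge eN A(2) unfolding N_def by linarith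
    have "c * (real (card A) / 2) \<le> c * real (card (A \<inter> Y))"
      using AY c by (intro mult_left_mono) auto
    also have "\<dots> < real (card (vertex_boundary (G \<restriction> Y) (A \<inter> Y)))"
      using AY A_pos True by (intro expander_induce_subgraph_vertex_boundary[OF Y(2)]) auto
    also have "\<dots> \<le> real (card (vertex_boundary G A))"
      using Y(1) vertex_boundary_induce_subgraph[of "A \<inter> Y" Y]
      by (intro of_nat_mono card_mono bd_fin) (auto simp: vertex_boundary_def)
    also have "\<dots> \<le> (real D + 1) * real (card (vertex_boundary G A))"
      by (simp add: algebra_simps)
    finally show ?thesis by simp
  next
    case False
    define B where "B = Y - A"
    have aN: "\<alpha> * N \<le> N / 2"
      using mult_right_mono[OF \<alpha>(2), of N] N by simp
    have "card (A \<inter> Y) \<le> card A" using fin by (intro card_mono) auto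
    \<comment> \<open>Here \<open>\<epsilon> * N \<le> N / 4\<close>, so \<open>card B\<close> is at
      least \<open>3/4 * N - card A\<close>, and \<open>3/4 * N\<close> is at least
      \<open>3/2 * card A\<close> because \<open>A\<close> is at most half of the graph.\<close>
    then have B_ge: "real (card A) / 2 \<le> real (card B)"
      using Y_ge eN aN A(3) Y_split unfolding N_def B_def by linarith
    have "c * (real (card A) / 2) \<le> c * real (card B)"
      using B_ge c by (intro mult_left_mono) auto
    also have "\<dots> < real (card (vertex_boundary (G \<restriction> Y) B))"
    proof (rule expander_induce_subgraph_vertex_boundary[OF Y(2)])
      show "B \<subseteq> Y" by (auto simp: B_def)
      show "B \<noteq> {}" using B_ge A_pos by auto
      show "2 * card B \<le> card Y" using False Y_split unfolding B_def by linarith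
    qed
    \<comment> \<open>A boundary point of \<open>B\<close> in \<open>Y\<close> belongs to
      \<open>A\<close>, and its neighbour in \<open>B\<close> lies in the boundary of
      \<open>A\<close>.\<close>
    also have "\<dots> \<le> real (D * card (vertex_boundary G A))"
    proof (rule of_nat_mono, rule card_neighbours_le[OF deg vertex_boundary_subset])
      fix x assume "x \<in> vertex_boundary (G \<restriction> Y) B"
      then obtain b where "x \<in> A" "b \<in> B" "x \<rightarrow>\<^bsub>G\<^esub> b"
        using vertex_boundary_induce_subgraph[of B Y] by (auto simp: B_def)
      then show "\<exists>t\<in>vertex_boundary G A. t \<rightarrow>\<^bsub>G\<^esub> x"
        using dominates_sym Y(1) by (auto simp: vertex_boundary_def B_def)
    qed
    also have "\<dots> \<le> (real D + 1) * real (card (vertex_boundary G A))"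
      by (simp add: algebra_simps)
    finally show ?thesis by simp
  qed
  then show ?thesis by (simp add: field_simps)
qed

end


section \<open>Asymptotic expanders and exhaustion by expanders\<close>

lemma asymptotic_expanders_imp_uniform_exhaustion:
  fixes X :: "nat \<Rightarrow> ('a, 'b) pre_digraph"
  assumes graph: "\<And>n. graph (X n)"
    and conn: "\<And>n. Digraph_Component.connected (X n)"
    and bdd: "uniformly_bounded_degrees X"
    and lim: "filterlim (\<lambda>n. card (verts (X n))) at_top sequentially"
    and exp: "asymptotic_expanders (\<lambda>n. verts (X n)) (\<lambda>n. path_metric (X n))"
  shows "uniform_exhaustion_by_expanders X"
proof -
  obtain D where D: "\<And>n v. v \<in> verts (X n) \<Longrightarrow> out_degree (X n) v \<le> D"
    using bdd unfolding uniformly_bounded_degrees_def by blast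
  have ne: "verts (X n) \<noteq> {}" for n
    using conn[of n] by (auto simp: Digraph_Component.connected_def strongly_connected_def)
  \<comment> \<open>The shift by 4 keeps every \<open>\<alpha> k\<close> at most \<open>1/4\<close>,
    as the extraction of a large expander requires.\<close>
  define \<alpha> where "\<alpha> = (\<lambda>k. 1 / real (k + 4))"
  have \<alpha>: "0 < \<alpha> k" "\<alpha> k \<le> 1/4" for k
    by (auto simp: \<alpha>_def field_simps)
  have \<alpha>_lim: "\<alpha> \<longlonglongrightarrow> 0"
    unfolding \<alpha>_def by (rule LIMSEQ_ignore_initial_segment[OF lim_1_over_n])
  have "\<exists>c>0. \<forall>n. \<exists>Y\<subseteq>verts (X n). expander c (X n \<restriction> Y) \<and>
      (1 - \<alpha> k) * real (card (verts (X n))) \<le> real (card Y)" for k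
  proof -
    have "\<alpha> k \<le> 1/2" using \<alpha>(2)[of k] by simp
    with \<alpha>(1)[of k] have "0 < \<alpha> k \<and> \<alpha> k \<le> 1/2" by simp
    from exp[unfolded asymptotic_expanders_def, THEN conjunct2, THEN conjunct2, THEN spec, THEN mp, OF this]
    obtain c R where c: "0 < c" and
      "\<forall>n. \<forall>A\<subseteq>verts (X n). \<alpha> k * real (card (verts (X n))) \<le> real (card A) \<and>
        real (card A) \<le> 1/2 * real (card (verts (X n))) \<longrightarrow>
        c * real (card A) < real (card (metric_boundary (verts (X n)) (path_metric (X n)) R A))"
      by (elim exE conjE)
    then have cR: "c * real (card A) < real (card (metric_boundary (verts (X n)) (path_metric (X n)) R A))"
      if "A \<subseteq> verts (X n)" "\<alpha> k * real (card (verts (X n))) \<le> real (card A)"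
        "real (card A) \<le> 1/2 * real (card (verts (X n)))" for n A
      using that by blast
    obtain m where m: "R \<le> real m" using real_arch_simple by blast
    \<comment> \<open>\<open>K\<close> is the cost of passing from \<open>R\<close>-boundaries to
      vertex boundaries. It depends on \<open>k\<close> but not on \<open>n\<close>, so the
      expansion constant is uniform in \<open>n\<close>; the term \<open>D ^ 0\<close> keeps it
      positive even for \<open>D = 0\<close>.\<close>
    define K where "K = (\<Sum>i<Suc m. D ^ i)"
    have "K \<ge> D ^ 0" unfolding K_def by (rule member_le_sum) auto
    then have K: "K > 0" by simp
    have "\<exists>Y\<subseteq>verts (X n). expander (c / real K / (4 * real D + 4)) (X n \<restriction> Y) \<and>
      (1 - \<alpha> k) * real (card (verts (X n))) \<le> real (card Y)" for n
    proof (rule graph.exists_large_expander_subgraph[OF graph D \<alpha> _ ne])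
      show "0 < c / real K" using c K by simp
      fix A assume A: "A \<subseteq> verts (X n)" "\<alpha> k * real (card (verts (X n))) \<le> real (card A)"
        "real (card A) \<le> 1/2 * real (card (verts (X n)))"
      have "card (metric_boundary (verts (X n)) (path_metric (X n)) R A)
          \<le> K * card (vertex_boundary (X n) A)"
        unfolding K_def by (rule graph.card_metric_boundary_le[OF graph conn D A(1) m])
      then have "real (card (metric_boundary (verts (X n)) (path_metric (X n)) R A))
          \<le> real K * real (card (vertex_boundary (X n) A))"
        by (metis of_nat_le_iff of_nat_mult)
      with cR[OF A] have "c * real (card A) < real K * real (card (vertex_boundary (X n) A))"
        by linarith
      with K show "c / real K * real (card A) < real (card (vertex_boundary (X n) A))"
        by (simp add: field_simps)
    qed
    then show ?thesis
      using c K by (intro exI[of _ "c / real K / (4 * real D + 4)"]) simp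
  qed
  then obtain c where c: "\<And>k. 0 < c k"
    and ex: "\<And>k n. \<exists>Y\<subseteq>verts (X n). expander (c k) (X n \<restriction> Y) \<and>
      (1 - \<alpha> k) * real (card (verts (X n))) \<le> real (card Y)"
    by metis
  then obtain Y where "\<And>n k. Y n k \<subseteq> verts (X n) \<and> expander (c k) (X n \<restriction> Y n k) \<and>
      (1 - \<alpha> k) * real (card (verts (X n))) \<le> real (card (Y n k))"
    by metis
  with c \<alpha>_lim show ?thesis
    unfolding uniform_exhaustion_by_expanders_def using graph bdd lim by blast
qed

text \<open>For given \<open>\<alpha>\<close>, one index \<open>k\<close> with
  \<open>\<epsilon> k \<le> \<alpha> / 2\<close> serves all \<open>n\<close>. Expansion then holds
  for vertex boundaries, so the radius 1 works for every \<open>\<alpha>\<close>.\<close>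

lemma uniform_exhaustion_imp_asymptotic_expanders:
  fixes X :: "nat \<Rightarrow> ('a, 'b) pre_digraph"
  assumes conn: "\<And>n. Digraph_Component.connected (X n)"
    and exh: "uniform_exhaustion_by_expanders X"
  shows "asymptotic_expanders (\<lambda>n. verts (X n)) (\<lambda>n. path_metric (X n))"
proof -
  have graph: "\<And>n. graph (X n)" and bdd: "uniformly_bounded_degrees X"
    and lim: "filterlim (\<lambda>n. card (verts (X n))) at_top sequentially"
    using exh unfolding uniform_exhaustion_by_expanders_def by auto
  obtain \<epsilon> c Y where c: "\<And>k. 0 < c k" and \<epsilon>_lim: "\<epsilon> \<longlonglongrightarrow> (0::real)"
    and Y: "\<And>n k. Y n k \<subseteq> verts (X n)" "\<And>n k. expander (c k) (X n \<restriction> Y n k)"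
      "\<And>n k. (1 - \<epsilon> k) * real (card (verts (X n))) \<le> real (card (Y n k))"
    using exh unfolding uniform_exhaustion_by_expanders_def by blast
  obtain D where D: "\<And>n v. v \<in> verts (X n) \<Longrightarrow> out_degree (X n) v \<le> D"
    using bdd unfolding uniformly_bounded_degrees_def by blast
  have ne: "verts (X n) \<noteq> {}" for n
    using conn[of n] by (auto simp: Digraph_Component.connected_def strongly_connected_def)
  have fin: "finite (verts (X n))" for n
    using graph[of n] by (simp add: graph_def digraph_def fin_digraph.finite_verts)
  have "\<exists>c' R. 0 < c' \<and> c' < 1 \<and> 0 < R \<and> (\<forall>n. \<forall>A\<subseteq>verts (X n).
      \<alpha> * real (card (verts (X n))) \<le> real (card A) \<and> real (card A) \<le> 1/2 * real (card (verts (X n))) \<longrightarrow>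
      c' * real (card A) < real (card (metric_boundary (verts (X n)) (path_metric (X n)) R A)))"
    if \<alpha>: "0 < \<alpha>" "\<alpha> \<le> 1/2" for \<alpha> :: real
  proof -
    have "eventually (\<lambda>k. \<epsilon> k < \<alpha> / 2) sequentially"
      using \<alpha> by (intro order_tendstoD(2)[OF \<epsilon>_lim]) simp
    then obtain k where k: "\<epsilon> k \<le> \<alpha> / 2"
      by (auto simp: eventually_sequentially intro: less_imp_le)
    \<comment> \<open>The minimum with \<open>1/2\<close> only secures
      \<open>c' < 1\<close>.\<close>
    define c' where "c' = min (1/2) (c k / (2 * real D + 2))"
    have "c' * real (card A) < real (card (metric_boundary (verts (X n)) (path_metric (X n)) 1 A))"
      if A: "A \<subseteq> verts (X n)" "\<alpha> * real (card (verts (X n))) \<le> real (card A)"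
        "real (card A) \<le> 1/2 * real (card (verts (X n)))" for n A
    proof -
      have "c' * real (card A) \<le> c k / (2 * real D + 2) * real (card A)"
        by (intro mult_right_mono) (auto simp: c'_def)
      also have "\<dots> < real (card (vertex_boundary (X n) A))"
        by (rule graph.expander_subgraph_imp_vertex_boundary[OF graph D \<alpha> k c ne Y A])
      also have "\<dots> \<le> real (card (metric_boundary (verts (X n)) (path_metric (X n)) 1 A))"
        by (intro of_nat_mono card_mono
            graph.vertex_boundary_subset_metric_boundary[OF graph])
          (simp add: metric_boundary_def fin)
      finally show ?thesis .
    qed
    moreover have "0 < c'" "c' < 1" using c by (auto simp: c'_def)
    ultimately show ?thesis
      by (intro exI[of _ c'] exI[of _ "1::real"]) auto
  qed
  then show ?thesis
    unfolding asymptotic_expanders_def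
    using lim fin graph.Metric_space_path_metric[OF graph conn] by auto
qed

theorem theoremA:
  fixes X :: "nat \<Rightarrow> ('a, 'b) pre_digraph"
  assumes "\<And>n. graph (X n)"
    and "\<And>n. Digraph_Component.connected (X n)"
    and "uniformly_bounded_degrees X"
    and "filterlim (\<lambda>n. card (verts (X n))) at_top sequentially"
  shows "asymptotic_expanders (\<lambda>n. verts (X n)) (\<lambda>n. path_metric (X n)) \<longleftrightarrow>
         uniform_exhaustion_by_expanders X"
  using asymptotic_expanders_imp_uniform_exhaustion[OF assms]
    uniform_exhaustion_imp_asymptotic_expanders[of X, OF assms(2)] by blast

end
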